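(* The irreducible elements of $\mathbb{Z}[j]$ lying in $\mathbb{Z}[j]\setminus\mathcal{D}$ that are not prime are exactly the associates of the elements $(2^n+1)+j(2^n-1)$ and $(2^n+1)-j(2^n-1)$, where $n$ ranges over all integers $n\geq 0$.
   Context: $\mathbb{Z}[j]$ denotes the commutative ring of formal expressions $x+jy$ with $x,y\in\mathbb{Z}$, with componentwise addition and multiplication determined by distributivity and $j^2=1$; that is, $\mathbb{Z}[j]\cong\mathbb{Z}[X]/(X^2-1)$. $\mathcal{D}=\{x\pm jx : x\in\mathbb{Z}\}$ is its set of zero divisors (including $0$). An element $p$ is prime if it is non-zero, not a unit, and $p\mid xy$ implies $p\mid x$ or $p\mid y$. An element $a$ is irreducible if it is non-zero, not a unit, and $a=zw$ implies that $z$ is a unit or $w$ is a unit. The associates of $z$ are the elements $uz$ with $u$ a unit. *)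

theory Defs
  imports "HOL-Computational_Algebra.Factorial_Ring"
begin

(* HC x y stands for the formal expression x + j y. *)
datatype hcint = HC (re: int) (hy: int)

instantiation hcint :: comm_ring_1
begin

definition "0 = HC 0 0"
definition "1 = HC 1 0"
definition "z + w = HC (re z + re w) (hy z + hy w)"
definition "- z = HC (- re z) (- hy z)"
definition "z - w = HC (re z - re w) (hy z - hy w)"
definition "z * w = HC (re z * re w + hy z * hy w) (re z * hy w + hy z * re w)"

instance
  by standard
    (simp_all add: zero_hcint_def one_hcint_def plus_hcint_def uminus_hcint_def
      minus_hcint_def times_hcint_def algebra_simps)

end

definition jj :: hcint where
  "jj = HC 0 1"

lemma jj_squared: "jj ^ 2 = 1"
  by (simp add: jj_def power2_eq_square times_hcint_def one_hcint_def)

lemma of_int_hcint: "of_int x = HC x 0"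
proof -
  have nat: "of_nat n = HC (int n) 0" for n
    by (induction n) (simp_all add: zero_hcint_def one_hcint_def plus_hcint_def)
  show ?thesis
    by (cases x rule: int_diff_cases) (simp add: nat minus_hcint_def)
qed

lemma HC_eq: "HC x y = of_int x + jj * of_int y"
  by (simp add: of_int_hcint jj_def plus_hcint_def times_hcint_def)

definition zero_divs :: "hcint set" where
  "zero_divs = {of_int x + jj * of_int x | x. True} \<union> {of_int x - jj * of_int x | x. True}"

lemma zero_divs_iff: "z \<in> zero_divs \<longleftrightarrow> (\<exists>w. w \<noteq> 0 \<and> z * w = 0)"
proof
  assume "z \<in> zero_divs"
  then obtain x where "z = HC x x \<or> z = HC x (- x)"
    by (auto simp: zero_divs_def of_int_hcint jj_def plus_hcint_def minus_hcint_def times_hcint_def)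
  then have "z * HC 1 (-1) = 0 \<or> z * HC 1 1 = 0"
    by (auto simp: times_hcint_def zero_hcint_def)
  moreover have "HC 1 (-1) \<noteq> 0" "HC 1 1 \<noteq> 0"
    by (simp_all add: zero_hcint_def)
  ultimately show "\<exists>w. w \<noteq> 0 \<and> z * w = 0"
    by blast
next
  assume "\<exists>w. w \<noteq> 0 \<and> z * w = 0"
  then obtain w where w: "w \<noteq> 0" "z * w = 0" by blast
  obtain a b where z: "z = HC a b" by (cases z)
  obtain c d where cd: "w = HC c d" by (cases w)
  have e: "a * c + b * d = 0" "a * d + b * c = 0"
    using w(2) by (simp_all add: z cd times_hcint_def zero_hcint_def)
  have "(a + b) * (c + d) = (a * c + b * d) + (a * d + b * c)"
       "(a - b) * (c - d) = (a * c + b * d) - (a * d + b * c)"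
    by (simp_all add: algebra_simps)
  then have "(a + b) * (c + d) = 0" "(a - b) * (c - d) = 0"
    unfolding e by simp_all
  moreover have "c \<noteq> 0 \<or> d \<noteq> 0"
    using w(1) by (auto simp: cd zero_hcint_def)
  ultimately have "b = a \<or> b = - a"
    by auto
  then show "z \<in> zero_divs"
    by (auto simp: z zero_divs_def of_int_hcint jj_def plus_hcint_def minus_hcint_def times_hcint_def)
qed

definition associates :: "hcint \<Rightarrow> hcint set" where
  "associates z = {u * z | u. u dvd 1}"

end

theory Submission
  imports Defs "HOL-Computational_Algebra.Primes"
begin

text \<open>
  The map \<open>x + j y \<mapsto> (x + y, x - y)\<close> identifies the ring with the pairs of integers of equal
  parity under componentwise operations. There a non-zero-divisor with odd components factors as
  \<open>(a, b) = (a, 1) (1, b)\<close>, so it is irreducible only if, up to units, it is \<open>(p, 1)\<close> or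
  \<open>(1, p)\<close> with \<open>p\<close> an odd prime; these are prime elements. An element \<open>(a, b)\<close> with non-zero
  even components is never prime: it divides the square of \<open>(a, 2 b)\<close> but not \<open>(a, 2 b)\<close> itself.
  Odd factors of either component split off, and so does \<open>(2, 2)\<close> if both components are divisible
  by 4, which leaves \<open>(2^k, 2)\<close> and \<open>(2, 2^k)\<close> with \<open>k \<ge> 1\<close>.
\<close>

section \<open>Coordinates: pairs of integers of equal parity\<close>

definition pl :: "hcint \<Rightarrow> int" where "pl z = re z + hy z"
definition mi :: "hcint \<Rightarrow> int" where "mi z = re z - hy z"

text \<open>Inverts \<open>z\<close> to \<open>(pl z, mi z)\<close>, but only on pairs of equal
  parity. For mixed parity \<open>div\<close> rounds, hence the side condition
  \<open>even (a + b)\<close> wherever it is used.\<close>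

definition of_pair :: "int \<Rightarrow> int \<Rightarrow> hcint" where
  "of_pair a b = HC ((a + b) div 2) ((a - b) div 2)"

lemma pl_of_pair [simp]: "even (a + b) \<Longrightarrow> pl (of_pair a b) = a"
  and mi_of_pair [simp]: "even (a + b) \<Longrightarrow> mi (of_pair a b) = b"
  by (auto simp: pl_def mi_def of_pair_def; presburger)+

lemma hcint_eqI: "pl z = pl w \<Longrightarrow> mi z = mi w \<Longrightarrow> z = w"
  by (cases z; cases w) (simp add: pl_def mi_def)

lemma even_mi_iff: "even (mi z) \<longleftrightarrow> even (pl z)"
  by (simp add: pl_def mi_def)

lemma pl_simps [simp]:
  "pl 0 = 0" "pl 1 = 1" "pl (z * w) = pl z * pl w" "pl (z + w) = pl z + pl w"
  "pl (z - w) = pl z - pl w" "pl jj = 1"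
  by (simp_all add: pl_def zero_hcint_def one_hcint_def times_hcint_def plus_hcint_def
      minus_hcint_def jj_def algebra_simps)

lemma mi_simps [simp]:
  "mi 0 = 0" "mi 1 = 1" "mi (z * w) = mi z * mi w" "mi (z + w) = mi z + mi w"
  "mi (z - w) = mi z - mi w" "mi jj = -1"
  by (simp_all add: mi_def zero_hcint_def one_hcint_def times_hcint_def plus_hcint_def
      minus_hcint_def jj_def algebra_simps)

lemma pl_power [simp]: "pl (z ^ n) = pl z ^ n"
  and mi_power [simp]: "mi (z ^ n) = mi z ^ n"
  by (induction n) simp_all

lemma pl_two [simp]: "pl 2 = 2" and mi_two [simp]: "mi 2 = 2"
  using pl_simps(4)[of 1 1] mi_simps(4)[of 1 1] by simp_all

lemma is_unit_hcint_iff: "z dvd 1 \<longleftrightarrow> \<bar>pl z\<bar> = 1 \<and> \<bar>mi z\<bar> = 1"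
proof
  assume "z dvd 1"
  then obtain w where "1 = z * w" ..
  then have "1 = pl z * pl w" "1 = mi z * mi w"
    by (metis pl_simps(2,3), metis mi_simps(2,3))
  then show "\<bar>pl z\<bar> = 1 \<and> \<bar>mi z\<bar> = 1"
    by (metis dvd_triv_left zdvd1_eq)
next
  assume "\<bar>pl z\<bar> = 1 \<and> \<bar>mi z\<bar> = 1"
  \<comment> \<open>Both components are 1 or -1, so \<open>z\<close> is its own inverse.\<close>
  then have "1 = z * z"
    by (intro hcint_eqI) (auto simp: abs_if split: if_splits)
  then show "z dvd 1" ..
qed

lemma zero_divs_iff_pl_mi: "z \<in> zero_divs \<longleftrightarrow> pl z = 0 \<or> mi z = 0"
  by (cases z)
    (auto simp: zero_divs_def of_int_hcint jj_def plus_hcint_def minus_hcint_def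
      times_hcint_def pl_def mi_def)

text \<open>All four sign pairs have equal parity and so occur as units: the signs of the two
  components can be changed independently.\<close>

lemma associates_iff: "z \<in> associates w \<longleftrightarrow> \<bar>pl z\<bar> = \<bar>pl w\<bar> \<and> \<bar>mi z\<bar> = \<bar>mi w\<bar>"
proof
  assume "z \<in> associates w"
  then show "\<bar>pl z\<bar> = \<bar>pl w\<bar> \<and> \<bar>mi z\<bar> = \<bar>mi w\<bar>"
    by (auto simp: associates_def is_unit_hcint_iff abs_mult)
next
  assume *: "\<bar>pl z\<bar> = \<bar>pl w\<bar> \<and> \<bar>mi z\<bar> = \<bar>mi w\<bar>"
  define s t :: int where "s = (if pl z = pl w then 1 else -1)"
    and "t = (if mi z = mi w then 1 else -1)"
  have "even (s + t)" by (simp add: s_def t_def)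
  moreover have "pl z = s * pl w" "mi z = t * mi w"
    using * by (auto simp: s_def t_def)
  moreover have "\<bar>s\<bar> = 1" "\<bar>t\<bar> = 1" by (simp_all add: s_def t_def)
  ultimately have "z = of_pair s t * w" "of_pair s t dvd 1"
    by (intro hcint_eqI, simp_all add: is_unit_hcint_iff)
  then show "z \<in> associates w"
    by (auto simp: associates_def)
qed

text \<open>This is the conjugation x + j y to x - j y, a ring automorphism. It swaps the two
  components, so that each symmetric case has to be proved only once.\<close>

definition hconj :: "hcint \<Rightarrow> hcint" where "hconj z = of_pair (mi z) (pl z)"

lemma pl_hconj [simp]: "pl (hconj z) = mi z"
  and mi_hconj [simp]: "mi (hconj z) = pl z"
  by (simp_all add: hconj_def even_mi_iff)

lemma hconj_hconj [simp]: "hconj (hconj z) = z"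
  and hconj_mult: "hconj (z * w) = hconj z * hconj w"
  by (simp_all add: hcint_eqI)

lemma hconj_dvd_iff: "hconj z dvd w \<longleftrightarrow> z dvd hconj w"
  by (metis hconj_hconj hconj_mult dvd_def)

lemma is_unit_hconj [simp]: "hconj z dvd 1 \<longleftrightarrow> z dvd 1"
  by (auto simp: is_unit_hcint_iff)

lemma hconj_eq_0_iff [simp]: "hconj z = 0 \<longleftrightarrow> z = 0"
  by (metis hconj_hconj hcint_eqI mi_hconj mi_simps(1) pl_hconj pl_simps(1))

lemma irreducible_hconj: "irreducible z \<Longrightarrow> irreducible (hconj z)"
  unfolding irreducible_def by (metis hconj_hconj hconj_eq_0_iff hconj_mult is_unit_hconj)

lemma prime_elem_hconj: "prime_elem z \<Longrightarrow> prime_elem (hconj z)"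
  unfolding prime_elem_def
  by (metis hconj_dvd_iff hconj_eq_0_iff hconj_mult is_unit_hconj)

section \<open>Elements with odd components\<close>

lemma irreducible_odd_imp_prime_elem_aux:
  assumes irr: "irreducible z" and odd: "odd (pl z)" and unit: "\<bar>mi z\<bar> = 1"
  shows "prime_elem z"
proof -
  \<comment> \<open>Reduces the claim to the integers, where irreducible elements are prime. The
    second component of the quotient is \<open>mi z * mi w\<close>, as \<open>mi z\<close> is its
    own inverse; since \<open>pl z\<close> is odd, the integer quotient \<open>c\<close> has the
    parity of \<open>pl w\<close>, so the pair lies in the ring.\<close>
  have dvd_iff: "z dvd w \<longleftrightarrow> pl z dvd pl w" for w
  proof
    assume "pl z dvd pl w"
    then obtain c where c: "pl w = pl z * c" ..
    have "even (c + mi z * mi w)"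
      using c odd unit even_mi_iff[of w] even_mi_iff[of z] by auto
    then have "w = z * of_pair c (mi z * mi w)"
      using c unit by (intro hcint_eqI) (auto simp: abs_if split: if_splits)
    then show "z dvd w" ..
  qed auto
  have "irreducible (pl z)"
  proof (rule irreducibleI)
    show "pl z \<noteq> 0" using odd by auto
    show "\<not> pl z dvd 1"
      using irr unit by (auto simp: irreducible_def is_unit_hcint_iff)
    fix c d assume cd: "pl z = c * d"
    \<comment> \<open>An integer factorization of \<open>pl z\<close> lifts to one of
      \<open>z\<close> by adding the second components 1 and \<open>mi z\<close>; all four entries
      are odd.\<close>
    then have "even (c + 1)" "even (d + mi z)"
      using odd even_mi_iff[of z] by auto
    moreover from this have "z = of_pair c 1 * of_pair d (mi z)"
      using cd by (intro hcint_eqI) simp_all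
    then have "of_pair c 1 dvd 1 \<or> of_pair d (mi z) dvd 1"
      using irr by (auto simp: irreducible_def)
    ultimately show "c dvd 1 \<or> d dvd 1"
      by (auto simp: is_unit_hcint_iff)
  qed
  then have "prime_elem (pl z)" by (rule irreducible_imp_prime_elem)
  then show ?thesis
    using unit odd unfolding prime_elem_def dvd_iff is_unit_hcint_iff by auto
qed

lemma irreducible_odd_imp_prime_elem:
  assumes irr: "irreducible z" and odd: "odd (pl z)"
  shows "prime_elem z"
proof -
  have odd': "odd (mi z)" using odd by (simp add: even_mi_iff)
  have "z = of_pair (pl z) 1 * of_pair 1 (mi z)"
    using odd odd' by (intro hcint_eqI) simp_all
  then have "of_pair (pl z) 1 dvd 1 \<or> of_pair 1 (mi z) dvd 1"
    using irr by (auto simp: irreducible_def)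
  then consider "\<bar>mi z\<bar> = 1" | "\<bar>mi (hconj z)\<bar> = 1"
    using odd odd' by (auto simp: is_unit_hcint_iff)
  then show ?thesis
  proof cases
    case 1
    with irr odd show ?thesis by (rule irreducible_odd_imp_prime_elem_aux)
  next
    case 2
    then have "prime_elem (hconj z)"
      using irr odd' by (intro irreducible_odd_imp_prime_elem_aux irreducible_hconj) simp_all
    from prime_elem_hconj[OF this] show ?thesis by simp
  qed
qed

section \<open>Elements with even components\<close>

lemma even_imp_not_prime_elem:
  assumes "pl z \<noteq> 0" "mi z \<noteq> 0" "even (pl z)"
  shows "\<not> prime_elem z"
proof
  assume prime: "prime_elem z"
  \<comment> \<open>The quotient of \<open>w\<close> by \<open>z\<close> would be (1, 2), of mixed
    parity, whereas the quotient of \<open>w * w\<close> by \<open>z\<close> has two even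
    components.\<close>
  define w where "w = of_pair (pl z) (2 * mi z)"
  have w: "pl w = pl z" "mi w = 2 * mi z"
    using assms by (simp_all add: w_def)
  have "w * w = z * of_pair (pl z) (4 * mi z)"
    using assms by (intro hcint_eqI) (simp_all add: w)
  then have "z dvd w * w" ..
  then have "z dvd w" using prime by (simp add: prime_elem_dvd_mult_iff)
  then obtain v where "w = z * v" ..
  then have "pl z = pl z * pl v" "2 * mi z = mi z * mi v"
    using w by simp_all
  then have "pl v = 1" "mi v = 2" using assms by simp_all
  then show False using even_mi_iff[of v] by simp
qed

text \<open>Since \<open>m\<close> is odd, \<open>a\<close> stays even. Hence (a, mi z) and (m, 1)
  both lie in the ring and multiply to \<open>z\<close>, and the first, having even components, is
  not a unit.\<close>

lemma irreducible_even_split_odd: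
  assumes irr: "irreducible z" and "even (pl z)" and "pl z = a * m" "odd m"
  shows "\<bar>m\<bar> = 1"
proof -
  have "even a" "even (mi z)" using assms by (auto simp: even_mi_iff)
  then have "z = of_pair a (mi z) * of_pair m 1" "\<not> of_pair a (mi z) dvd 1"
    using assms by (auto intro!: hcint_eqI simp: is_unit_hcint_iff dest: arg_cong[of _ _ even])
  then have "of_pair m 1 dvd 1" using irr by (auto simp: irreducible_def)
  then show ?thesis using \<open>odd m\<close> by (simp add: is_unit_hcint_iff)
qed

text \<open>The odd part of \<open>pl z\<close> is a unit by the preceding lemma; evenness excludes
  the exponent 0, hence \<open>Suc n\<close>.\<close>

lemma irreducible_even_pl_power_2:
  assumes irr: "irreducible z" and "even (pl z)" "pl z \<noteq> 0"
  obtains n where "\<bar>pl z\<bar> = 2 ^ Suc n"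
proof -
  obtain m where m: "pl z = 2 ^ multiplicity 2 (pl z) * m" "odd m"
    using multiplicity_decompose'[of "pl z" 2] assms by auto
  then have "\<bar>m\<bar> = 1" using irreducible_even_split_odd assms by blast
  then have eq: "\<bar>pl z\<bar> = 2 ^ multiplicity 2 (pl z)"
    by (subst m(1)) (simp add: abs_mult)
  have "multiplicity 2 (pl z) \<noteq> 0"
    using eq \<open>even (pl z)\<close> by (metis odd_one power_0 dvd_abs_iff)
  then show thesis using that eq by (metis not0_implies_Suc)
qed

lemma irreducible_even_cases:
  assumes irr: "irreducible z" and even: "even (pl z)" and nz: "pl z \<noteq> 0" "mi z \<noteq> 0"
  obtains n where "\<bar>pl z\<bar> = 2 ^ Suc n" "\<bar>mi z\<bar> = 2"
  | n where "\<bar>pl z\<bar> = 2" "\<bar>mi z\<bar> = 2 ^ Suc n"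
proof -
  obtain k where k: "\<bar>pl z\<bar> = 2 ^ Suc k"
    using irreducible_even_pl_power_2 irr even nz by blast
  obtain l where l: "\<bar>mi z\<bar> = 2 ^ Suc l"
    using irreducible_even_pl_power_2[of "hconj z"] irreducible_hconj[OF irr] even nz
    by (auto simp: even_mi_iff)
  have "k = 0 \<or> l = 0"
  proof (rule ccontr)
    assume "\<not> (k = 0 \<or> l = 0)"
    then obtain k' l' where "k = Suc k'" "l = Suc l'" by (meson not0_implies_Suc)
    \<comment> \<open>With both exponents at least 2, the element 2 = (2, 2) splits off and leaves a
      cofactor with even components, which is in the ring and not a unit.\<close>
    then have "4 dvd \<bar>pl z\<bar>" "4 dvd \<bar>mi z\<bar>" by (simp_all add: k l)
    then obtain a b where ab: "pl z = 4 * a" "mi z = 4 * b" by (auto elim!: dvdE)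
    then have "z = 2 * of_pair (2 * a) (2 * b)" by (intro hcint_eqI) simp_all
    moreover have "\<bar>2 * a\<bar> \<noteq> 1" by presburger
    then have "\<not> of_pair (2 * a) (2 * b) dvd 1" "\<not> (2 :: hcint) dvd 1"
      by (simp_all add: is_unit_hcint_iff del: abs_mult)
    ultimately show False using irr by (auto simp: irreducible_def)
  qed
  then show thesis using that k l by auto
qed

text \<open>A divisor with odd components divides powers of 2 componentwise, so it is a unit. Two
  factors with even components would make \<open>mi z\<close> divisible by 4.\<close>

lemma irreducible_power_2_aux:
  assumes pl: "\<bar>pl z\<bar> = 2 ^ Suc n" and mi: "\<bar>mi z\<bar> = 2"
  shows "irreducible z"
proof (rule irreducibleI)
  show "z \<noteq> 0" using mi by auto
  show "\<not> z dvd 1" using mi by (simp add: is_unit_hcint_iff)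
  have unit: "v dvd 1" if "v dvd z" "odd (mi v)" for v
  proof -
    have "pl v dvd 2 ^ Suc n" "mi v dvd 2"
      using that(1) pl mi by (metis dvd_abs_iff dvd_def pl_simps(3), 
          metis dvd_abs_iff dvd_def mi_simps(3))
    moreover have "coprime (pl v) (2 ^ Suc n)" "coprime (mi v) 2"
      using that(2) by (simp_all add: even_mi_iff)
    ultimately have "pl v dvd 1" "mi v dvd 1"
      by (meson coprime_common_divisor dvd_refl)+
    then show ?thesis by (simp add: is_unit_hcint_iff)
  qed
  fix v w assume vw: "z = v * w"
  have "\<not> (even (mi v) \<and> even (mi w))"
  proof
    assume "even (mi v) \<and> even (mi w)"
    then have "4 dvd \<bar>mi z\<bar>" using mult_dvd_mono[of 2 "mi v" 2 "mi w"] by (simp add: vw)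
    then show False using mi by simp
  qed
  then show "v dvd 1 \<or> w dvd 1" using unit vw by auto
qed

lemma irreducible_power_2:
  assumes "\<bar>pl z\<bar> = 2 ^ Suc n \<and> \<bar>mi z\<bar> = 2 \<or> \<bar>pl z\<bar> = 2 \<and> \<bar>mi z\<bar> = 2 ^ Suc n"
  shows "irreducible z"
  using assms irreducible_power_2_aux[of z n] irreducible_power_2_aux[of "hconj z" n]
    irreducible_hconj[of "hconj z"] by auto

theorem corollary4:
  "{z :: hcint. z \<notin> zero_divs \<and> irreducible z \<and> \<not> prime_elem z} =
   (\<Union>n :: nat. associates ((2 ^ n + 1) + jj * (2 ^ n - 1)) \<union>
              associates ((2 ^ n + 1) - jj * (2 ^ n - 1)))"
  (is "?L = (\<Union>n. ?R n)")
proof -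
  \<comment> \<open>The sum and difference of 2^n + 1 and 2^n - 1 are 2^(n+1) and 2, so the two
    generators are the pairs (2^(n+1), 2) and (2, 2^(n+1)).\<close>
  have R: "z \<in> ?R n \<longleftrightarrow>
      \<bar>pl z\<bar> = 2 ^ Suc n \<and> \<bar>mi z\<bar> = 2 \<or> \<bar>pl z\<bar> = 2 \<and> \<bar>mi z\<bar> = 2 ^ Suc n" for z n
    by (simp add: associates_iff)
  show ?thesis
  proof (intro equalityI subsetI)
    fix z assume "z \<in> ?L"
    then have z: "irreducible z" "\<not> prime_elem z" "pl z \<noteq> 0" "mi z \<noteq> 0"
      by (simp_all add: zero_divs_iff_pl_mi)
    then have "even (pl z)" using irreducible_odd_imp_prime_elem by blast
    with z obtain n where "z \<in> ?R n"
      unfolding R by (metis irreducible_even_cases)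
    then show "z \<in> (\<Union>n. ?R n)" by blast
  next
    fix z assume "z \<in> (\<Union>n. ?R n)"
    then obtain n where z: "\<bar>pl z\<bar> = 2 ^ Suc n \<and> \<bar>mi z\<bar> = 2 \<or> \<bar>pl z\<bar> = 2 \<and> \<bar>mi z\<bar> = 2 ^ Suc n"
      using R by blast
    then have nz: "pl z \<noteq> 0" "mi z \<noteq> 0" by auto
    have "even \<bar>pl z\<bar>" using z by (elim disjE conjE) simp_all
    then have "\<not> prime_elem z" using even_imp_not_prime_elem nz by simp
    then show "z \<in> ?L"
      using irreducible_power_2[OF z] nz by (simp add: zero_divs_iff_pl_mi)
  qed
qed

end
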